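(* Let $(Q,+)$ be a group, $\overline{\varphi},\overline{\psi}$ anti-automorphisms of $(Q,+)$, and $\beta,\delta\in S_Q$. The left alinear quasigroups $(Q,\cdot)$ and $(Q,\circ)$ given by $x\cdot y=\overline{\varphi}x+\beta y$ and $x\circ y=\overline{\psi}x+\delta y$ are orthogonal if and only if the mapping $((\overline{\varphi})^{-1}\beta-(\overline{\psi})^{-1}\delta)$, i.e. $y\mapsto(\overline{\varphi})^{-1}\beta y-(\overline{\psi})^{-1}\delta y$, is a permutation of the set $Q$.
   Context: Groups are written additively but need not be commutative. $S_Q$ is the set of all permutations (bijections) of the set $Q$. Products of maps are compositions, $(\alpha\beta)x=\alpha(\beta x)$. An anti-automorphism of $(Q,+)$ is a permutation $\overline{\varphi}$ of $Q$ with $\overline{\varphi}(x+y)=\overline{\varphi}y+\overline{\varphi}x$ for all $x,y$. Two quasigroups $(Q,\cdot)$ and $(Q,\circ)$ on the same set are orthogonal if for all $a,b\in Q$ the system $x\cdot y=a$, $x\circ y=b$ has a unique solution $(x,y)\in Q\times Q$. A quasigroup of the form $x\cdot y=\overline{\varphi}x+\beta y$ with $\overline\varphi$ an anti-automorphism and $\beta\in S_Q$ is called left alinear. *)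

theory Defs
  imports Main
begin

text \<open>The class \<^class>\<open>group_add\<close> does not assume commutativity. Groups and
  quasigroups have a whole type as their underlying set \<open>Q\<close>, so the permutations
  of \<open>Q\<close> are the functions satisfying \<^const>\<open>bij\<close>.\<close>

definition anti_automorphism :: "('a::group_add \<Rightarrow> 'a) \<Rightarrow> bool" where
  "anti_automorphism \<phi> \<longleftrightarrow> bij \<phi> \<and> (\<forall>x y. \<phi> (x + y) = \<phi> y + \<phi> x)"

definition quasigroup :: "('a \<Rightarrow> 'a \<Rightarrow> 'a) \<Rightarrow> bool" where
  "quasigroup f \<longleftrightarrow> (\<forall>a b. (\<exists>!x. f a x = b) \<and> (\<exists>!y. f y a = b))"

text \<open>Orthogonality is a relation between quasigroups, so both operations are
  required to be quasigroups.\<close>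

definition orthogonal_quasigroups :: "('a \<Rightarrow> 'a \<Rightarrow> 'a) \<Rightarrow> ('a \<Rightarrow> 'a \<Rightarrow> 'a) \<Rightarrow> bool" where
  "orthogonal_quasigroups f g \<longleftrightarrow> quasigroup f \<and> quasigroup g \<and>
     (\<forall>a b. \<exists>!p. case p of (x, y) \<Rightarrow> f x y = a \<and> g x y = b)"

end

theory Submission
  imports Defs
begin

text \<open>Applying the anti-automorphisms \<open>inv \<phi>\<close> and \<open>inv \<psi>\<close> turns the system
  \<open>\<phi> x + \<beta> y = a\<close>, \<open>\<psi> x + \<delta> y = b\<close> into \<open>u y + x = inv \<phi> a\<close>, \<open>v y + x = inv \<psi> b\<close>
  with \<open>u = inv \<phi> \<circ> \<beta>\<close> and \<open>v = inv \<psi> \<circ> \<delta>\<close>. Now \<open>x\<close> stands on the right in both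
  equations, so subtracting them cancels it and leaves \<open>u y - v y = inv \<phi> a - inv \<psi> b\<close>.\<close>

lemma anti_automorphism_inv:
  assumes "anti_automorphism \<phi>"
  shows "anti_automorphism (inv \<phi>)"
proof -
  have b: "bij \<phi>" and add: "\<And>x y. \<phi> (x + y) = \<phi> y + \<phi> x"
    using assms by (auto simp: anti_automorphism_def)
  have "inv \<phi> (x + y) = inv \<phi> y + inv \<phi> x" for x y
  proof -
    \<comment> \<open>\<open>\<phi>\<close> reverses the two summands once more, which restores the
      order \<open>x + y\<close>; bijectivity then transfers the identity to
      \<open>inv \<phi>\<close>.\<close>
    have "\<phi> (inv \<phi> y + inv \<phi> x) = x + y"
      using b by (simp add: add bij_is_surj surj_f_inv_f)
    then show ?thesis
      using b by (metis bij_inv_eq_iff)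
  qed
  then show ?thesis
    using b by (simp add: anti_automorphism_def bij_imp_bij_inv)
qed

text \<open>Injectivity of \<open>inv \<phi>\<close> makes its application to both sides reversible,
  so no solutions are gained or lost.\<close>

lemma left_alinear_eq_iff:
  fixes \<phi> \<beta> :: "'a::group_add \<Rightarrow> 'a"
  assumes "anti_automorphism \<phi>"
  shows "\<phi> x + \<beta> y = a \<longleftrightarrow> (inv \<phi> \<circ> \<beta>) y + x = inv \<phi> a"
proof -
  have b: "bij \<phi>" and i: "anti_automorphism (inv \<phi>)"
    using assms anti_automorphism_inv by (auto simp: anti_automorphism_def)
  have "inv \<phi> (\<phi> x + \<beta> y) = (inv \<phi> \<circ> \<beta>) y + x"
    using i b by (simp add: anti_automorphism_def bij_is_inj)
  moreover have "inj (inv \<phi>)"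
    using i by (simp add: anti_automorphism_def bij_is_inj)
  ultimately show ?thesis
    by (metis injD)
qed

text \<open>This discharges the quasigroup conjuncts of orthogonality, leaving only unique
  solvability of the system.\<close>

lemma quasigroup_left_alinear:
  fixes \<phi> \<beta> :: "'a::group_add \<Rightarrow> 'a"
  assumes "bij \<phi>" and "bij \<beta>"
  shows "quasigroup (\<lambda>x y. \<phi> x + \<beta> y)"
proof -
  have "\<exists>!x. \<phi> a + \<beta> x = b" for a b
  proof -
    have "\<phi> a + \<beta> x = b \<longleftrightarrow> \<beta> x = - \<phi> a + b" for x
      by (auto simp: add.assoc [symmetric])
    then show ?thesis
      using assms(2) by (simp add: bij_iff)
  qed
  moreover have "\<exists>!x. \<phi> x + \<beta> a = b" for a b
  proof -
    have "\<phi> x + \<beta> a = b \<longleftrightarrow> \<phi> x = b - \<beta> a" for x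
      by (simp add: eq_diff_eq)
    then show ?thesis
      using assms(1) by (simp add: bij_iff)
  qed
  ultimately show ?thesis
    by (simp add: quasigroup_def)
qed

lemma unique_solution_iff_bij_diff:
  fixes u v :: "'b \<Rightarrow> 'a::group_add"
  shows "(\<forall>a b. \<exists>!p. case p of (x, y) \<Rightarrow> u y + x = a \<and> v y + x = b) \<longleftrightarrow>
    bij (\<lambda>y. u y - v y)"
proof -
  have eq: "u y + x = a \<and> v y + x = b \<longleftrightarrow> x = - v y + b \<and> u y - v y = a - b" for a b x y
  proof -
    have "v y + x = b \<longleftrightarrow> x = - v y + b"
      by (auto simp: add.assoc [symmetric])
    moreover have "u y + (- v y + b) = a \<longleftrightarrow> u y - v y = a - b"
      by (simp add: eq_diff_eq add.assoc [symmetric])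
    ultimately show ?thesis
      by auto
  qed
  \<comment> \<open>By \<open>eq\<close>, each \<open>y\<close> with
    \<open>u y - v y = a - b\<close> extends to exactly one solution, since \<open>x\<close> is then
    forced to be \<open>- v y + b\<close>. Unique pairs therefore correspond to unique
    \<open>y\<close>.\<close>
  have "(\<exists>!p. case p of (x, y) \<Rightarrow> u y + x = a \<and> v y + x = b) \<longleftrightarrow>
      (\<exists>!y. u y - v y = a - b)" for a b
    unfolding eq Ex1_def split_paired_Ex split_paired_All prod.case prod.inject by blast
  then have "(\<forall>a b. \<exists>!p. case p of (x, y) \<Rightarrow> u y + x = a \<and> v y + x = b) \<longleftrightarrow>
      (\<forall>a b. \<exists>!y. u y - v y = a - b)"
    by simp
  also have "\<dots> \<longleftrightarrow> (\<forall>c. \<exists>!y. u y - v y = c)"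
  proof (intro iffI allI)
    fix c
    assume "\<forall>a b. \<exists>!y. u y - v y = a - b"
    \<comment> \<open>Every \<open>c\<close> is a difference \<open>a - b\<close>: take
      \<open>a = c\<close> and \<open>b = 0\<close>.\<close>
    then have "\<exists>!y. u y - v y = c - 0"
      by (elim allE)
    then show "\<exists>!y. u y - v y = c"
      by simp
  qed (elim allE)
  finally show ?thesis
    by (simp only: bij_iff)
qed

theorem theorem29:
  fixes \<phi> \<psi> \<beta> \<delta> :: "'a::group_add \<Rightarrow> 'a"
  assumes "anti_automorphism \<phi>" and "anti_automorphism \<psi>"
    and "bij \<beta>" and "bij \<delta>"
  shows "orthogonal_quasigroups (\<lambda>x y. \<phi> x + \<beta> y) (\<lambda>x y. \<psi> x + \<delta> y) \<longleftrightarrow>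
    bij (\<lambda>y. (inv \<phi> \<circ> \<beta>) y - (inv \<psi> \<circ> \<delta>) y)"
proof -
  let ?u = "inv \<phi> \<circ> \<beta>" and ?v = "inv \<psi> \<circ> \<delta>"
  let ?sol = "\<lambda>a b. \<exists>!p. case p of (x, y) \<Rightarrow> ?u y + x = a \<and> ?v y + x = b"
  have bij: "bij \<phi>" "bij \<psi>"
    using assms by (auto simp: anti_automorphism_def)
  have "orthogonal_quasigroups (\<lambda>x y. \<phi> x + \<beta> y) (\<lambda>x y. \<psi> x + \<delta> y) \<longleftrightarrow>
      (\<forall>a b. ?sol (inv \<phi> a) (inv \<psi> b))"
    unfolding orthogonal_quasigroups_def
    using quasigroup_left_alinear [OF bij(1) assms(3)] quasigroup_left_alinear [OF bij(2) assms(4)]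
    by (simp only: left_alinear_eq_iff [OF assms(1)] left_alinear_eq_iff [OF assms(2)] simp_thms)
  also have "\<dots> \<longleftrightarrow> (\<forall>a b. ?sol a b)"
  proof (intro iffI allI)
    fix a b
    assume "\<forall>a b. ?sol (inv \<phi> a) (inv \<psi> b)"
    \<comment> \<open>The right-hand sides \<open>inv \<phi> a\<close> and
      \<open>inv \<psi> b\<close> range independently over the whole group, so they can be replaced
      by arbitrary elements.\<close>
    then have "?sol (inv \<phi> (\<phi> a)) (inv \<psi> (\<psi> b))"
      by (elim allE)
    then show "?sol a b"
      by (simp only: bij [THEN bij_is_inj, THEN inv_f_f])
  qed (elim allE)
  also have "\<dots> \<longleftrightarrow> bij (\<lambda>y. ?u y - ?v y)"
    by (rule unique_solution_iff_bij_diff)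
  finally show ?thesis .
qed

end
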